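(* Let $n\ge 0$ and let $(K,w_K)$ and $(H,w_H)$ be $(n+1)$-dimensional weighted simplicial complexes such that $(H,w_H)$ is a subcomplex of $(K,w_K)$ and their proper difference $(L,w_L)$ exists, i.e. $L=K$ as simplicial complexes, $w_L=w_K-w_H$ (with $w_H$ extended by $0$ to faces of $K$ not in $H$), and $\{F\in K : w_L(F)>0\}$ is a simplicial complex. Let $N=|S_n(K)|=\dim C^n(K,\mathbb{R})$ and let $\lambda_1\le\lambda_2\le\dots\le\lambda_N$ and $\theta_1\le\theta_2\le\dots\le\theta_N$ be the eigenvalues of $\mathcal{L}^{up}_n(K,w_K)$ and $\mathcal{L}^{up}_n(L,w_L)$, respectively. Put $D_{\mathcal{W}}=\dim C^{n+1}(H,\mathbb{R})-\dim H^{n+1}(H,\mathbb{R})$ and $D_H=\dim C^n(H,\mathbb{R})$, and use the convention $\lambda_j=0$ for $j\le 0$. Then $$\theta_k\le\lambda_{k+D_H}\quad\text{for all } k=1,\dots,N-D_H,$$ and $$\lambda_{k-D_{\mathcal{W}}}\le\theta_k\quad\text{for all } k=1,\dots,N.$$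
   Context: A finite abstract simplicial complex $K$ is a family of finite subsets of a vertex set closed under taking subsets; $S_j(K)$ is its set of $j$-faces (faces with $j+1$ vertices). An oriented simplex $[F]$ is a face with an ordering of its vertices, two orderings giving the same orientation iff they differ by an even permutation. $C^j(K,\mathbb{R})$ is the real vector space of functions $f$ on oriented $j$-faces with $f$ changing sign when the orientation is reversed; it has the basis of elementary cochains $e_{[F]}$, $F\in S_j(K)$. The coboundary $\delta_j:C^j\to C^{j+1}$ is $(\delta_j f)([v_0,\dots,v_{j+1}])=\sum_{i=0}^{j+1}(-1)^i f([v_0,\dots,\hat v_i,\dots,v_{j+1}])$. For an oriented $(j+1)$-face $[\bar F]=[v_0,\dots,v_{j+1}]$ and $[F_i]=[v_0,\dots,\hat v_i,\dots,v_{j+1}]$, $\mathrm{sgn}([F_i],\partial[\bar F])=(-1)^i$ (and the sign changes if the orientation of $F_i$ is reversed). A weight function is $w:\bigcup_j S_j(K)\to[0,\infty)$; $(K,w)$ is a weighted simplicial complex if $w>0$ everywhere and a degenerate weighted simplicial complex if zero values are allowed. The weights define $(f,g)=\sum_{F\in S_j(K)}w(F)f([F])g([F])$ on $C^j(K,\mathbb{R})$. The (formal) adjoint $\delta_j^*:C^{j+1}\to C^j$ is $(\delta_j^*\bar f)([F])=\sum_{\bar F\in S_{j+1}(K),\,F\subset\bar F}\frac{w(\bar F)}{w(F)}\mathrm{sgn}([F],\partial[\bar F])\bar f([\bar F])$ if $w(F)\ne 0$ and $0$ if $w(F)=0$. The $n$-th up-Laplacian is $\mathcal{L}^{up}_n(K,w)=\delta_n^*\delta_n:C^n(K,\mathbb{R})\to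 C^n(K,\mathbb{R})$; its eigenvalues are real and listed with multiplicity. A weighted complex $(H,w_H)$ is a subcomplex of $(K,w_K)$ if $H$ is a subcomplex of $K$ and $w_H(F)\le w_K(F)$ for all faces $F$ of $H$. $H^{n+1}(H,\mathbb{R})$ is the simplicial cohomology of $H$ with real coefficients. *)

theory Defs
  imports "HOL-Analysis.Analysis" "HOL-Computational_Algebra.Polynomial" "HOL-Library.Multiset" "HOL-Library.Function_Algebras"
begin

text \<open>Faces are nonempty finite subsets of a linearly ordered vertex type.  The linear order
  of the vertices fixes a reference orientation of every face (vertices listed increasingly);
  a cochain is stored by its values on these reference orientations, i.e. by its coordinates
  in the basis of elementary cochains.\<close>

definition is_complex :: "'v set set \<Rightarrow> bool" where
  "is_complex K \<longleftrightarrow> finite K \<and> (\<forall>F\<in>K. finite F \<and> (\<forall>G. G \<subseteq> F \<and> G \<noteq> {} \<longrightarrow> G \<in> K))"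

definition faces :: "'v set set \<Rightarrow> nat \<Rightarrow> 'v set set" where
  "faces K j = {F \<in> K. card F = j + 1}"

definition is_dim :: "'v set set \<Rightarrow> nat \<Rightarrow> bool" where
  "is_dim K d \<longleftrightarrow> (\<exists>F\<in>K. card F = d + 1) \<and> (\<forall>F\<in>K. card F \<le> d + 1)"

definition weighted_complex :: "'v set set \<Rightarrow> ('v set \<Rightarrow> real) \<Rightarrow> bool" where
  "weighted_complex K w \<longleftrightarrow> is_complex K \<and> (\<forall>F\<in>K. F \<noteq> {} \<longrightarrow> w F > 0)"

definition degen_weighted_complex :: "'v set set \<Rightarrow> ('v set \<Rightarrow> real) \<Rightarrow> bool" where
  "degen_weighted_complex K w \<longleftrightarrow> is_complex K \<and> (\<forall>F\<in>K. F \<noteq> {} \<longrightarrow> w F \<ge> 0)"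

definition weighted_subcomplex ::
  "'v set set \<Rightarrow> ('v set \<Rightarrow> real) \<Rightarrow> 'v set set \<Rightarrow> ('v set \<Rightarrow> real) \<Rightarrow> bool" where
  "weighted_subcomplex H wH K wK \<longleftrightarrow> is_complex H \<and> is_complex K \<and> H \<subseteq> K \<and>
     (\<forall>F\<in>H. F \<noteq> {} \<longrightarrow> wH F \<le> wK F)"

definition ext_weight :: "'v set set \<Rightarrow> ('v set \<Rightarrow> real) \<Rightarrow> 'v set \<Rightarrow> real" where
  "ext_weight H wH F = (if F \<in> H then wH F else 0)"

definition proper_difference ::
  "'v set set \<Rightarrow> ('v set \<Rightarrow> real) \<Rightarrow> 'v set set \<Rightarrow> ('v set \<Rightarrow> real) \<Rightarrow>
   'v set set \<Rightarrow> ('v set \<Rightarrow> real) \<Rightarrow> bool" where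
  "proper_difference K wK H wH L wL \<longleftrightarrow> weighted_subcomplex H wH K wK \<and> L = K \<and>
     (\<forall>F\<in>K. F \<noteq> {} \<longrightarrow> wL F = wK F - ext_weight H wH F) \<and>
     is_complex {F \<in> K. F \<noteq> {} \<and> wL F > 0}"

text \<open>sgn([F], \<partial>[Fb]) for reference orientations, where F = Fb - {x}: (-1)^i with i the
  position of x in the increasing enumeration of Fb\<close>
definition osgn :: "'v::linorder set \<Rightarrow> 'v set \<Rightarrow> real" where
  "osgn F Fb = (-1) ^ card {v \<in> Fb. v < the_elem (Fb - F)}"

definition cochains :: "'v set set \<Rightarrow> nat \<Rightarrow> ('v set \<Rightarrow> real) set" where
  "cochains K j = {f. \<forall>F. F \<notin> faces K j \<longrightarrow> f F = 0}"

definition coboundary :: "'v::linorder set set \<Rightarrow> nat \<Rightarrow> ('v set \<Rightarrow> real) \<Rightarrow> 'v set \<Rightarrow> real" where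
  "coboundary K j f Fb = (if Fb \<in> faces K (j + 1)
      then (\<Sum>x\<in>Fb. (-1) ^ card {v \<in> Fb. v < x} * f (Fb - {x})) else 0)"

definition coboundary_adj ::
  "'v::linorder set set \<Rightarrow> ('v set \<Rightarrow> real) \<Rightarrow> nat \<Rightarrow> ('v set \<Rightarrow> real) \<Rightarrow> 'v set \<Rightarrow> real" where
  "coboundary_adj K w j g F = (if F \<in> faces K j \<and> w F \<noteq> 0
      then (\<Sum>Fb\<in>{Fb \<in> faces K (j + 1). F \<subset> Fb}. w Fb / w F * osgn F Fb * g Fb) else 0)"

definition up_laplacian ::
  "'v::linorder set set \<Rightarrow> ('v set \<Rightarrow> real) \<Rightarrow> nat \<Rightarrow> ('v set \<Rightarrow> real) \<Rightarrow> 'v set \<Rightarrow> real" where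
  "up_laplacian K w n f = coboundary_adj K w n (coboundary K n f)"

definition elem_cochain :: "'v set \<Rightarrow> 'v set \<Rightarrow> real" where
  "elem_cochain F = (\<lambda>G. if G = F then 1 else 0)"

definition charpoly_on :: "'a set \<Rightarrow> ('a \<Rightarrow> 'a \<Rightarrow> real) \<Rightarrow> real poly" where
  "charpoly_on S M = (\<Sum>p\<in>{p. p permutes S}. of_int (sign p) *
      (\<Prod>i\<in>S. (if p i = i then [:0, 1:] else 0) - [:M i (p i):]))"

definition up_laplacian_matrix :: "'v::linorder set set \<Rightarrow> ('v set \<Rightarrow> real) \<Rightarrow> nat \<Rightarrow> 'v set \<Rightarrow> 'v set \<Rightarrow> real" where
  "up_laplacian_matrix K w n F G = up_laplacian K w n (elem_cochain G) F"

definition up_eigenvalues :: "'v::linorder set set \<Rightarrow> ('v set \<Rightarrow> real) \<Rightarrow> nat \<Rightarrow> real list" where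
  "up_eigenvalues K w n =
     sorted_list_of_multiset (proots (charpoly_on (faces K n) (up_laplacian_matrix K w n)))"

definition eig :: "real list \<Rightarrow> int \<Rightarrow> real" where
  "eig ls j = (if j \<le> 0 then 0 else ls ! nat (j - 1))"

definition fun_scale :: "real \<Rightarrow> ('a \<Rightarrow> real) \<Rightarrow> 'a \<Rightarrow> real" where
  "fun_scale c f = (\<lambda>x. c * f x)"

definition vdim :: "('a \<Rightarrow> real) set \<Rightarrow> nat" where
  "vdim V = vector_space.dim fun_scale V"

text \<open>dim H^j(K,R) = dim ker \<delta>_j - dim im \<delta>_(j-1), for j \<ge> 1\<close>
definition cohomology_dim :: "'v::linorder set set \<Rightarrow> nat \<Rightarrow> nat" where
  "cohomology_dim K j =
     vdim {f \<in> cochains K j. coboundary K j f = (\<lambda>_. 0)} - vdim (coboundary K (j - 1) ` cochains K (j - 1))"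

end

theory Submission
  imports Defs "Jordan_Normal_Form.Char_Poly"
begin

text \<open>The eigenvalues of the up-Laplacian are those of the pencil of the quadratic forms
  \<open>E f = \<Sum> w Fb * (\<delta> f Fb)\<^sup>2\<close> and \<open>(f, f) = \<Sum> w F * (f F)\<^sup>2\<close>, where zero weights in the second
  form may be replaced by arbitrary positive ones. The forms \<open>E\<close> of \<open>K\<close> and \<open>L\<close> agree on cochains
  whose coboundary vanishes on \<open>H\<close>, a subspace of codimension at most \<open>DW\<close>; there the quadratic
  form \<open>(f, f)\<close> of \<open>L\<close> is at most that of \<open>K\<close>. On the smaller subspace of cochains vanishing on
  \<open>H\<close>, of codimension \<open>DH\<close>, both pairs of forms agree. A dimension count in the manner of
  Courant--Fischer, intersecting such a subspace with a span of low eigenvectors of one pencil and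
  a span of high eigenvectors of the other, yields both inequalities.\<close>

section \<open>Eigenbases of symmetric pencils\<close>

text \<open>Gaussian elimination: an equation with a nonzero coefficient at \<open>p\<close> is
  solved for the unknown \<open>p\<close>, leaving one equation and one unknown fewer. Arbitrary
  index types allow disjoint sums of index sets later on.\<close>

lemma homogeneous_system_nontrivial:
  fixes a :: "'j \<Rightarrow> 'i \<Rightarrow> real"
  assumes "finite J" "finite I" "card J < card I"
  shows "\<exists>c. (\<exists>i\<in>I. c i \<noteq> 0) \<and> (\<forall>j\<in>J. (\<Sum>i\<in>I. a j i * c i) = 0)"
  using assms
proof (induction J arbitrary: I a rule: finite_induct)
  case empty
  then have "I \<noteq> {}" by auto
  then show ?case by (intro exI[of _ "\<lambda>_. 1"]) auto
next
  case (insert j J)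
  show ?case
  proof (cases "\<forall>i\<in>I. a j i = 0")
    case True
    obtain c where "\<exists>i\<in>I. c i \<noteq> 0" "\<forall>j\<in>J. (\<Sum>i\<in>I. a j i * c i) = 0"
      using insert.IH[of I a] insert.prems insert.hyps by (auto simp: card_insert_if)
    with True show ?thesis by auto
  next
    case False
    then obtain p where p: "p \<in> I" "a j p \<noteq> 0" by auto
    let ?b = "\<lambda>k i. a k i - a k p / a j p * a j i"
    have "card J < card (I - {p})"
      using insert.prems insert.hyps p by simp
    then obtain c where c: "\<exists>i\<in>I - {p}. c i \<noteq> 0"
      "\<forall>k\<in>J. (\<Sum>i\<in>I - {p}. ?b k i * c i) = 0"
      using insert.IH[of "I - {p}" ?b] insert.prems by auto
    define s where "s = (\<Sum>i\<in>I - {p}. a j i * c i)"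
    \<comment> \<open>The eliminated unknown gets the value that satisfies equation
      \<open>j\<close>; the equations \<open>?b\<close> are those of \<open>J\<close> after this
      substitution.\<close>
    define d where "d = c(p := - s / a j p)"
    have split: "(\<Sum>i\<in>I. a k i * d i) = a k p * d p + (\<Sum>i\<in>I - {p}. a k i * c i)" for k
      using p insert.prems by (subst sum.remove[of _ p]) (auto simp: d_def intro!: sum.cong)
    have "(\<Sum>i\<in>I. a j i * d i) = 0"
      using p by (subst split) (simp add: d_def s_def)
    moreover have "(\<Sum>i\<in>I. a k i * d i) = 0" if "k \<in> J" for k
    proof -
      have "0 = (\<Sum>i\<in>I - {p}. a k i * c i) - a k p / a j p * s"
        using c(2) that by (simp add: s_def sum_subtractf sum_distrib_left algebra_simps)
      then show ?thesis by (subst split) (simp add: d_def)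
    qed
    moreover have "\<exists>i\<in>I. d i \<noteq> 0" using c(1) by (auto simp: d_def)
    ultimately show ?thesis by blast
  qed
qed

section \<open>Weighted inner products and matrix forms on a finite index set\<close>

definition wip :: "'a set \<Rightarrow> ('a \<Rightarrow> real) \<Rightarrow> ('a \<Rightarrow> real) \<Rightarrow> ('a \<Rightarrow> real) \<Rightarrow> real" where
  "wip S W f g = (\<Sum>x\<in>S. W x * f x * g x)"

definition mat_app :: "'a set \<Rightarrow> ('a \<Rightarrow> 'a \<Rightarrow> real) \<Rightarrow> ('a \<Rightarrow> real) \<Rightarrow> 'a \<Rightarrow> real" where
  "mat_app S A f x = (\<Sum>y\<in>S. A x y * f y)"

definition bform :: "'a set \<Rightarrow> ('a \<Rightarrow> 'a \<Rightarrow> real) \<Rightarrow> ('a \<Rightarrow> real) \<Rightarrow> ('a \<Rightarrow> real) \<Rightarrow> real" where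
  "bform S A f g = (\<Sum>x\<in>S. f x * mat_app S A g x)"

text \<open>Solutions of the generalised eigenvalue problem \<open>A u = e W u\<close>, orthonormal
  for the weight \<open>W\<close>. The number \<open>k\<close> may be smaller than
  \<open>card S\<close>, so that a family can be built one vector at a time.\<close>

definition pencil_eigenbasis ::
  "'a set \<Rightarrow> ('a \<Rightarrow> 'a \<Rightarrow> real) \<Rightarrow> ('a \<Rightarrow> real) \<Rightarrow> nat \<Rightarrow> (nat \<Rightarrow> 'a \<Rightarrow> real) \<Rightarrow> (nat \<Rightarrow> real) \<Rightarrow> bool" where
  "pencil_eigenbasis S A W k u e \<longleftrightarrow>
     (\<forall>i<k. \<forall>j<k. wip S W (u i) (u j) = (if i = j then 1 else 0)) \<and>
     (\<forall>i<k. \<forall>x\<in>S. mat_app S A (u i) x = e i * W x * u i x)"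

lemma wip_commute: "wip S W f g = wip S W g f"
  by (simp add: wip_def mult_ac)

lemma wip_add_right: "wip S W f (\<lambda>x. g x + h x) = wip S W f g + wip S W f h"
  by (simp add: wip_def sum.distrib algebra_simps)

lemma wip_scale_right: "wip S W f (\<lambda>x. c * g x) = c * wip S W f g"
  by (simp add: wip_def sum_distrib_left algebra_simps)

lemma wip_sum_right: "wip S W f (\<lambda>x. \<Sum>i\<in>I. c i * g i x) = (\<Sum>i\<in>I. c i * wip S W f (g i))"
  unfolding wip_def sum_distrib_left
  by (subst sum.swap) (simp add: mult_ac)

lemma wip_cong:
  "(\<And>x. x \<in> S \<Longrightarrow> f x = f' x) \<Longrightarrow> (\<And>x. x \<in> S \<Longrightarrow> g x = g' x) \<Longrightarrow> wip S W f g = wip S W f' g'"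
  by (simp add: wip_def)

lemma mat_app_cong: "(\<And>x. x \<in> S \<Longrightarrow> f x = f' x) \<Longrightarrow> mat_app S A f = mat_app S A f'"
  by (simp add: mat_app_def fun_eq_iff)

lemma bform_cong:
  "(\<And>x. x \<in> S \<Longrightarrow> f x = f' x) \<Longrightarrow> (\<And>x. x \<in> S \<Longrightarrow> g x = g' x) \<Longrightarrow> bform S A f g = bform S A f' g'"
  using mat_app_cong[of S g g' A] by (simp add: bform_def)

lemma bform_add_right: "bform S A f (\<lambda>x. g x + h x) = bform S A f g + bform S A f h"
  by (simp add: bform_def mat_app_def sum.distrib algebra_simps)

lemma bform_scale_right: "bform S A f (\<lambda>x. c * g x) = c * bform S A f g"
  by (simp add: bform_def mat_app_def sum_distrib_left algebra_simps)

lemma bform_commute: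
  assumes "\<And>x y. x \<in> S \<Longrightarrow> y \<in> S \<Longrightarrow> A x y = A y x"
  shows "bform S A f g = bform S A g f"
proof -
  have "bform S A f g = (\<Sum>y\<in>S. \<Sum>x\<in>S. f x * (A x y * g y))"
    unfolding bform_def mat_app_def sum_distrib_left by (rule sum.swap)
  also have "\<dots> = bform S A g f"
    unfolding bform_def mat_app_def sum_distrib_left
    by (intro sum.cong refl) (simp add: assms mult_ac)
  finally show ?thesis .
qed

lemma bform_sum_right:
  "bform S A f (\<lambda>x. \<Sum>i\<in>I. c i * g i x) = (\<Sum>i\<in>I. c i * bform S A f (g i))"
proof -
  have "mat_app S A (\<lambda>x. \<Sum>i\<in>I. c i * g i x) x = (\<Sum>i\<in>I. c i * mat_app S A (g i) x)" for x
    unfolding mat_app_def sum_distrib_left by (subst sum.swap) (simp add: mult_ac)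
  then show ?thesis
    unfolding bform_def by (simp add: sum_distrib_left) (subst sum.swap, simp add: mult_ac)
qed

lemma bform_eigenvector_right:
  assumes "\<And>x. x \<in> S \<Longrightarrow> mat_app S A g x = e * W x * g x"
  shows "bform S A f g = e * wip S W f g"
  using assms by (simp add: bform_def wip_def sum_distrib_left mult_ac)

lemma wip_nonneg: "(\<And>x. x \<in> S \<Longrightarrow> W x \<ge> 0) \<Longrightarrow> wip S W f f \<ge> 0"
  by (auto simp: wip_def mult.assoc intro!: sum_nonneg)

lemma wip_eq_0_iff:
  assumes "finite S" "\<And>x. x \<in> S \<Longrightarrow> W x > 0"
  shows "wip S W f f = 0 \<longleftrightarrow> (\<forall>x\<in>S. f x = 0)"
proof -
  have "wip S W f f = 0 \<longleftrightarrow> (\<forall>x\<in>S. W x * (f x * f x) = 0)"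
    unfolding wip_def mult.assoc
    by (rule sum_nonneg_eq_0_iff) (auto simp: assms less_imp_le)
  also have "\<dots> \<longleftrightarrow> (\<forall>x\<in>S. f x = 0)" using assms(2) by fastforce
  finally show ?thesis .
qed

section \<open>Maximising the Rayleigh quotient\<close>

lemma compact_coordinate_box:
  fixes R :: "'a \<Rightarrow> real"
  shows "compact {f. \<forall>x. \<bar>f x\<bar> \<le> R x}"
proof -
  \<comment> \<open>Tychonoff's theorem: the box is a product of compact intervals, and functions
    carry the product topology.\<close>
  have "compactin (product_topology (\<lambda>_. euclidean) UNIV) (PiE UNIV (\<lambda>x. {- R x..R x}))"
    by (subst compactin_PiE) auto
  moreover have "PiE UNIV (\<lambda>x. {- R x..R x}) = {f. \<forall>x. \<bar>f x\<bar> \<le> R x}"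
    by (auto simp: PiE_def Pi_def abs_le_iff; smt)
  ultimately show ?thesis by (simp add: euclidean_product_topology)
qed

lemma quadratic_nonneg_imp_linear_coeff_0:
  fixes p q :: real
  assumes "\<And>t. 2 * t * p + t\<^sup>2 * q \<ge> 0" "q \<ge> 0"
  shows "p = 0"
proof -
  \<comment> \<open>The denominator \<open>q + 1\<close> instead of the \<open>q\<close> of the
    exact minimiser avoids a separate case \<open>q = 0\<close>.\<close>
  define t where "t = - p / (q + 1)"
  have p: "p = - t * (q + 1)" using assms(2) by (simp add: t_def)
  have "2 * t * p + t\<^sup>2 * q = - (t\<^sup>2 * (q + 2))"
    by (simp add: p algebra_simps power2_eq_square)
  with assms(1)[of t] have "t\<^sup>2 * (q + 2) \<le> 0" by simp
  with assms(2) have "t = 0" by (simp add: mult_le_0_iff)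
  with p show ?thesis by simp
qed

text \<open>The new vector maximises the Rayleigh quotient on the orthogonal complement \<open>U\<close> of the
  given ones. The form \<open>h\<close> is then positive semidefinite on \<open>U\<close> and isotropic at the maximiser
  \<open>v\<close>, hence \<open>h v\<close> vanishes on \<open>U\<close>; applied to the residual \<open>z\<close> of the eigenvalue equation,
  which lies in \<open>U\<close>, this gives \<open>z = 0\<close>.\<close>

lemma pencil_eigenbasis_extend:
  assumes fin: "finite S" and W: "\<And>x. x \<in> S \<Longrightarrow> W x > 0"
    and sym: "\<And>x y. x \<in> S \<Longrightarrow> y \<in> S \<Longrightarrow> A x y = A y x"
    and basis: "pencil_eigenbasis S A W k u e" and k: "k < card S"
  shows "\<exists>v c. pencil_eigenbasis S A W (Suc k) (u(k := v)) (e(k := c))"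
proof -
  define U where "U = {f. \<forall>i<k. wip S W (u i) f = 0}"
  \<comment> \<open>The unit sphere of \<open>U\<close>. Values off \<open>S\<close> are pinned to
    0, since free coordinates would destroy compactness in the function type.\<close>
  define C where "C = {f \<in> U. wip S W f f = 1 \<and> (\<forall>x. x \<notin> S \<longrightarrow> f x = 0)}"
  have eq0: "wip S W f f = 0 \<longleftrightarrow> (\<forall>x\<in>S. f x = 0)" for f
    by (rule wip_eq_0_iff) (use fin W in auto)
  have wip_pos: "wip S W f f > 0" if "\<exists>x\<in>S. f x \<noteq> 0" for f
    using that eq0[of f] wip_nonneg[of S W f] W by (metis less_le)
  \<comment> \<open>Truncation to \<open>S\<close> and rescaling do not change the Rayleigh
    quotient, so its maximum over \<open>C\<close> bounds it on all of \<open>U\<close>.\<close>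
  have normalise: "(\<lambda>x. 1 / sqrt (wip S W f f) * (if x \<in> S then f x else 0)) \<in> C"
    if "f \<in> U" "\<exists>x\<in>S. f x \<noteq> 0" for f
  proof -
    let ?g = "\<lambda>x. 1 / sqrt (wip S W f f) * (if x \<in> S then f x else 0)"
    have pos: "wip S W f f > 0"
      using that(2) by (rule wip_pos)
    have g: "wip S W h ?g = 1 / sqrt (wip S W f f) * wip S W h f" for h
      unfolding wip_scale_right by (rule arg_cong[where f = "(*) _"], rule wip_cong) auto
    have "wip S W ?g ?g = 1 / sqrt (wip S W f f) * (1 / sqrt (wip S W f f) * wip S W f f)"
      using g[of ?g] g[of f] by (simp only: wip_commute[of S W ?g f])
    also have "\<dots> = 1" using pos by (simp add: field_simps)
    finally show ?thesis using that(1) g by (simp add: C_def U_def)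
  qed
  have "C \<noteq> {}"
  proof -
    \<comment> \<open>Orthogonality to the given vectors imposes \<open>k\<close> linear conditions
      on \<open>card S > k\<close> unknowns.\<close>
    obtain f where f: "\<exists>x\<in>S. f x \<noteq> 0" "\<forall>i\<in>{..<k}. (\<Sum>x\<in>S. W x * u i x * f x) = 0"
      using homogeneous_system_nontrivial[of "{..<k}" S "\<lambda>i x. W x * u i x"] fin k by auto
    then have "f \<in> U" by (simp add: U_def wip_def)
    with normalise f(1) show ?thesis by blast
  qed
  have cont: "continuous_on X (\<lambda>f. wip S W (h f) (h' f))"
    if "\<And>x. continuous_on X (\<lambda>f. h f x)" "\<And>x. continuous_on X (\<lambda>f. h' f x)"
    for X :: "('a \<Rightarrow> real) set" and h h' :: "('a \<Rightarrow> real) \<Rightarrow> 'a \<Rightarrow> real"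
    unfolding wip_def by (intro continuous_on_sum continuous_on_mult continuous_on_const that)
  have coord: "continuous_on X (\<lambda>f. f x)" for X :: "('a \<Rightarrow> real) set" and x
    by (rule continuous_on_subset[OF continuous_on_product_coordinates]) simp
  have "closed C"
  proof -
    have "C = (\<Inter>i\<in>{..<k}. {f. wip S W (u i) f = 0}) \<inter> {f. wip S W f f = 1} \<inter>
        (\<Inter>x\<in>-S. {f. f x = 0})"
      by (auto simp: C_def U_def)
    also have "closed \<dots>"
      by (intro closed_Int closed_INT ballI closed_Collect_eq cont coord continuous_on_const)
    finally show ?thesis .
  qed
  moreover have "C \<subseteq> {f. \<forall>x. \<bar>f x\<bar> \<le> (if x \<in> S then 1 + 1 / W x else 0)}"
  proof clarify
    fix f x assume f: "f \<in> C"
    show "\<bar>f x\<bar> \<le> (if x \<in> S then 1 + 1 / W x else 0)"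
    proof (cases "x \<in> S")
      case True
      have "W x * f x * f x \<le> wip S W f f"
        unfolding wip_def using fin True W
        by (intro member_le_sum) (auto simp: mult.assoc less_imp_le)
      then have "(f x)\<^sup>2 \<le> 1 / W x"
        using f W[OF True] by (simp add: C_def field_simps power2_eq_square)
      \<comment> \<open>This bound keeps square roots out of the description of the box.\<close>
      moreover have "\<bar>f x\<bar> \<le> 1 + (f x)\<^sup>2"
        using zero_le_power2[of "\<bar>f x\<bar> - 1 / 2"] by (simp add: power2_eq_square algebra_simps)
      ultimately show ?thesis using True by simp
    qed (use f in \<open>auto simp: C_def\<close>)
  qed
  ultimately have "compact C"
    using compact_Int_closed[OF compact_coordinate_box[of "\<lambda>x. if x \<in> S then 1 + 1 / W x else 0"], of C]
    by (simp only: Int_absorb1)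
  moreover have "continuous_on C (\<lambda>f. bform S A f f)"
    unfolding bform_def mat_app_def
    by (intro continuous_on_sum continuous_on_mult continuous_on_const coord)
  ultimately obtain v where v: "v \<in> C" and max: "\<And>f. f \<in> C \<Longrightarrow> bform S A f f \<le> bform S A v v"
    using continuous_attains_sup[of C] \<open>C \<noteq> {}\<close> by blast
  define c where "c = bform S A v v"
  have bcomm: "bform S A f g = bform S A g f" for f g
    using sym by (rule bform_commute)
  define h where "h f g = c * wip S W f g - bform S A f g" for f g
  have vU: "v \<in> U" and vv: "wip S W v v = 1" using v by (auto simp: C_def)
  have h_nonneg: "h f f \<ge> 0" if "f \<in> U" for f
  proof (cases "\<exists>x\<in>S. f x \<noteq> 0")
    case True
    let ?s = "1 / sqrt (wip S W f f)" and ?f = "\<lambda>x. if x \<in> S then f x else 0"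
    have pos: "wip S W f f > 0"
      using True by (rule wip_pos)
    have "bform S A (\<lambda>x. ?s * ?f x) (\<lambda>x. ?s * ?f x) = ?s * (?s * bform S A ?f ?f)"
      by (simp only: bform_scale_right bcomm[of "\<lambda>x. ?s * ?f x" ?f])
    also have "\<dots> = bform S A f f / wip S W f f"
      using pos bform_cong[of S ?f f ?f f A] by (simp flip: mult.assoc)
    finally have "bform S A f f / wip S W f f \<le> c"
      using max[OF normalise[OF that True]] by (simp only: c_def)
    with pos show ?thesis by (simp add: h_def field_simps)
  next
    case False
    then have "wip S W f f = 0" "bform S A f f = 0"
      by (auto simp: wip_def bform_def)
    then show ?thesis by (simp add: h_def)
  qed
  have h_commute: "h f g = h g f" for f g
    using wip_commute[of S W f g] bcomm[of f g] by (simp add: h_def)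
  have h_lin: "h f (\<lambda>x. g x + t * g' x) = h f g + t * h f g'" for f g g' t
    by (simp add: h_def wip_add_right wip_scale_right bform_add_right bform_scale_right algebra_simps)
  have h_v: "h v g = 0" if g: "g \<in> U" for g
  proof (rule quadratic_nonneg_imp_linear_coeff_0)
    fix t
    let ?f = "\<lambda>x. v x + t * g x"
    have "?f \<in> U" using vU g by (simp add: U_def wip_add_right wip_scale_right)
    then have "0 \<le> h ?f ?f" by (rule h_nonneg)
    also have "\<dots> = h v v + t * h v g + t * (h g v + t * h g g)"
      by (simp only: h_lin h_commute[of ?f v] h_commute[of ?f g])
    also have "h v v = 0" by (simp add: h_def vv c_def)
    finally show "0 \<le> 2 * t * h v g + t\<^sup>2 * h g g"
      using h_commute[of g v] by (simp add: algebra_simps power2_eq_square)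
  qed (use h_nonneg g in auto)
  \<comment> \<open>Dividing by \<open>W\<close> makes \<open>z\<close> the vector that represents
    \<open>h v\<close> with respect to \<open>wip\<close>.\<close>
  define z where "z x = c * v x - mat_app S A v x / W x" for x
  have wip_z: "wip S W f z = h f v" for f
  proof -
    have "W x * f x * z x = c * (W x * f x * v x) - f x * mat_app S A v x" if "x \<in> S" for x
      using W[OF that] by (simp add: z_def algebra_simps)
    then show ?thesis
      by (simp add: h_def wip_def bform_def sum_subtractf sum_distrib_left)
  qed
  \<comment> \<open>By symmetry \<open>A\<close> can be moved onto \<open>u i\<close>, where it acts
    as \<open>e i * W\<close>; what remains is a multiple of \<open>wip S W (u i) v\<close>, which
    is 0.\<close>
  have "z \<in> U"
    unfolding U_def
  proof clarify
    fix i assume i: "i < k"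
    have "bform S A v (u i) = e i * wip S W v (u i)"
      using basis i by (intro bform_eigenvector_right) (auto simp: pencil_eigenbasis_def)
    moreover have "wip S W (u i) v = 0" using vU i by (simp add: U_def)
    ultimately show "wip S W (u i) z = 0"
      unfolding wip_z h_def using bcomm[of "u i" v] wip_commute[of S W v "u i"] by simp
  qed
  then have "wip S W z z = 0" using h_v wip_z h_commute by metis
  then have z0: "\<forall>x\<in>S. z x = 0" using eq0 by blast
  have "pencil_eigenbasis S A W (Suc k) (u(k := v)) (e(k := c))"
    unfolding pencil_eigenbasis_def
  proof (intro conjI allI impI ballI)
    fix i j assume "i < Suc k" "j < Suc k"
    then show "wip S W ((u(k := v)) i) ((u(k := v)) j) = (if i = j then 1 else 0)"
      using basis vU vv wip_commute[of S W v "u j"]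
      by (auto simp: pencil_eigenbasis_def U_def less_Suc_eq)
  next
    fix i x assume "i < Suc k" "x \<in> S"
    then show "mat_app S A ((u(k := v)) i) x = (e(k := c)) i * W x * (u(k := v)) i x"
      using basis z0 W[of x] by (auto simp: pencil_eigenbasis_def less_Suc_eq z_def field_simps)
  qed
  then show ?thesis by blast
qed

lemma pencil_eigenbasis_exists:
  assumes "finite S" "\<And>x. x \<in> S \<Longrightarrow> W x > 0"
    and "\<And>x y. x \<in> S \<Longrightarrow> y \<in> S \<Longrightarrow> A x y = A y x"
  obtains u e where "pencil_eigenbasis S A W (card S) u e"
proof -
  have "\<exists>u e. pencil_eigenbasis S A W k u e" if "k \<le> card S" for k
    using that
  proof (induction k)
    case 0
    show ?case by (simp add: pencil_eigenbasis_def)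
  next
    case (Suc k)
    then obtain u e where "pencil_eigenbasis S A W k u e" by auto
    then have "\<exists>v c. pencil_eigenbasis S A W (Suc k) (u(k := v)) (e(k := c))"
      by (rule pencil_eigenbasis_extend[rotated 3]) (use assms Suc in auto)
    then show ?case by blast
  qed
  then show ?thesis using that by blast
qed

section \<open>Characteristic polynomial and interlacing\<close>

text \<open>Both sides are Leibniz expansions. Conjugating permutations with the enumeration
  \<open>g\<close> matches their terms, and conjugation preserves signs.\<close>

lemma charpoly_on_reindex:
  assumes g: "bij_betw g {0..<N} S"
  shows "charpoly_on S M = char_poly (Matrix.mat N N (\<lambda>(i, j). M (g i) (g j)))"
proof -
  define A where "A = Matrix.mat N N (\<lambda>(i, j). M (g i) (g j))"
  have A: "A \<in> carrier_mat N N" by (simp add: A_def)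
  have inj: "inj_on g {0..<N}" and S: "g ` {0..<N} = S" using g by (auto simp: bij_betw_def)
  let ?\<phi> = "map_permutation {0..<N} g"
  have bij: "bij_betw ?\<phi> {p. p permutes {0..<N}} {p. p permutes S}"
  proof (rule bij_betw_cong[THEN iffD1, OF _ bij_betw_permutations[OF g]])
    fix p
    show "(\<lambda>x. if x \<in> S then g (p (inv_into {0..<N} g x)) else x) = ?\<phi> p"
      by (simp add: map_permutation_def restrict_id_def S fun_eq_iff)
  qed
  have "charpoly_on S M = (\<Sum>p | p permutes {0..<N}. of_int (sign (?\<phi> p)) *
      (\<Prod>x\<in>S. (if ?\<phi> p x = x then [:0, 1:] else 0) - [:M x (?\<phi> p x):]))"
    unfolding charpoly_on_def by (rule sum.reindex_bij_betw[OF bij, symmetric])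
  also have "\<dots> = (\<Sum>p | p permutes {0..<N}. of_int (sign p) *
      (\<Prod>i = 0..<N. char_poly_matrix A $$ (i, p i)))"
  proof (intro sum.cong refl)
    fix p assume "p \<in> {p. p permutes {0..<N}}"
    then have p: "p permutes {0..<N}" by simp
    have "(\<Prod>x\<in>S. (if ?\<phi> p x = x then [:0, 1:] else 0) - [:M x (?\<phi> p x):]) =
        (\<Prod>i = 0..<N. (if ?\<phi> p (g i) = g i then [:0, 1:] else 0) - [:M (g i) (?\<phi> p (g i)):])"
      by (rule prod.reindex_bij_betw[OF g, symmetric])
    also have "\<dots> = (\<Prod>i = 0..<N. char_poly_matrix A $$ (i, p i))"
    proof (intro prod.cong refl)
      fix i assume i: "i \<in> {0..<N}"
      then have pi: "p i \<in> {0..<N}" using p by (simp add: permutes_in_image)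
      have "?\<phi> p (g i) = g (p i)" using inj i by (rule map_permutation_apply)
      moreover have "g (p i) = g i \<longleftrightarrow> p i = i" using inj i pi by (simp add: inj_on_eq_iff)
      ultimately show "(if ?\<phi> p (g i) = g i then [:0, 1:] else 0) - [:M (g i) (?\<phi> p (g i)):] =
          char_poly_matrix A $$ (i, p i)"
        using i pi by (auto simp: char_poly_matrix_def A_def)
    qed
    finally show "of_int (sign (?\<phi> p)) *
        (\<Prod>x\<in>S. (if ?\<phi> p x = x then [:0, 1:] else 0) - [:M x (?\<phi> p x):]) =
        of_int (sign p) * (\<Prod>i = 0..<N. char_poly_matrix A $$ (i, p i))"
      using sign_map_permutation[OF inj p] by simp
  qed
  also have "\<dots> = char_poly A"
    unfolding char_poly_def by (rule det_def'[symmetric]) (use A in simp)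
  finally show ?thesis by (simp only: A_def)
qed

text \<open>Let the columns of \<open>P\<close> be the eigenvectors. Orthonormality says that
  \<open>Q\<close>, the transpose of \<open>P\<close> times the diagonal matrix of \<open>W\<close>,
  inverts \<open>P\<close>; the eigenvalue equations say \<open>B * P = P * D\<close>. So the matrix
  is similar to the diagonal matrix of eigenvalues.\<close>

lemma charpoly_on_eigenbasis:
  assumes fin: "finite S" and W: "\<And>x. x \<in> S \<Longrightarrow> W x > 0"
    and basis: "pencil_eigenbasis S A W (card S) u e"
    and M: "\<And>x y. x \<in> S \<Longrightarrow> y \<in> S \<Longrightarrow> M x y = A x y / W x"
  shows "charpoly_on S M = (\<Prod>c\<leftarrow>map e [0..<card S]. [:- c, 1:])"
proof -
  define N where "N = card S"
  obtain g where g: "bij_betw g {0..<N} S"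
    using ex_bij_betw_nat_finite[OF fin] by (auto simp: N_def)
  have gS: "g i \<in> S" if "i < N" for i using g that by (auto simp: bij_betw_def)
  have reindex: "(\<Sum>i = 0..<N. h (g i)) = (\<Sum>x\<in>S. h x)" for h :: "'a \<Rightarrow> real"
    by (rule sum.reindex_bij_betw[OF g])
  define B where "B = Matrix.mat N N (\<lambda>(i, j). M (g i) (g j))"
  define P where "P = Matrix.mat N N (\<lambda>(i, j). u j (g i))"
  define Q where "Q = Matrix.mat N N (\<lambda>(i, j). W (g j) * u i (g j))"
  define D where "D = mat_diag N e"
  have carr: "B \<in> carrier_mat N N" "P \<in> carrier_mat N N" "Q \<in> carrier_mat N N" "D \<in> carrier_mat N N"
    by (simp_all add: B_def P_def Q_def D_def)
  have QP: "Q * P = 1\<^sub>m N"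
  proof (rule eq_matI)
    fix i j assume "i < dim_row (1\<^sub>m N)" "j < dim_col (1\<^sub>m N)"
    then have ij: "i < N" "j < N" by auto
    have "(Q * P) $$ (i, j) = (\<Sum>k = 0..<N. W (g k) * u i (g k) * u j (g k))"
      using ij by (simp add: Q_def P_def scalar_prod_def)
    also have "\<dots> = wip S W (u i) (u j)"
      by (subst reindex) (simp add: wip_def)
    finally show "(Q * P) $$ (i, j) = 1\<^sub>m N $$ (i, j)"
      using basis ij by (simp add: pencil_eigenbasis_def N_def)
  qed (simp_all add: Q_def P_def)
  have PQ: "P * Q = 1\<^sub>m N"
    using mat_mult_left_right_inverse[OF carr(3,2) QP] .
  have BP: "B * P = P * D"
  proof (rule eq_matI)
    fix i j assume "i < dim_row (P * D)" "j < dim_col (P * D)"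
    then have ij: "i < N" "j < N" using carr by auto
    have "(B * P) $$ (i, j) = (\<Sum>k = 0..<N. M (g i) (g k) * u j (g k))"
      using ij by (simp add: B_def P_def scalar_prod_def)
    also have "\<dots> = (\<Sum>y\<in>S. M (g i) y * u j y)" by (rule reindex)
    also have "\<dots> = mat_app S A (u j) (g i) / W (g i)"
      by (simp add: mat_app_def sum_divide_distrib M[OF gS[OF ij(1)]])
    also have "\<dots> = u j (g i) * e j"
      using basis ij gS[OF ij(1)] W[OF gS[OF ij(1)]] by (simp add: pencil_eigenbasis_def N_def)
    finally show "(B * P) $$ (i, j) = (P * D) $$ (i, j)"
      unfolding D_def mat_diag_mult_right[OF carr(2)] using ij by (simp add: P_def)
  qed (use carr in auto)
  have "B = B * (P * Q)" using carr by (simp add: PQ)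
  also have "\<dots> = P * D * Q" using carr by (simp flip: BP)
  finally have "similar_mat B D"
    using similar_mat_witI[OF PQ QP] carr unfolding similar_mat_def by blast
  then have "char_poly B = char_poly D" by (rule char_poly_similar)
  also have "\<dots> = (\<Prod>c\<leftarrow>diag_mat D. [:- c, 1:])"
    by (rule char_poly_upper_triangular[OF carr(4)]) (auto simp: D_def mat_diag_def)
  also have "diag_mat D = map e [0..<N]"
    by (simp add: D_def mat_diag_def diag_mat_def)
  finally show ?thesis
    unfolding charpoly_on_reindex[OF g] B_def N_def .
qed

lemma pencil_eigenbasis_permute:
  assumes "pencil_eigenbasis S A W N u e" "p permutes {..<N}"
  shows "pencil_eigenbasis S A W N (u \<circ> p) (e \<circ> p)"
proof -
  have "p i < N \<longleftrightarrow> i < N" for i using permutes_in_image[OF assms(2), of i] by simp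
  moreover have "p i = p j \<longleftrightarrow> i = j" for i j
    using permutes_inj[OF assms(2)] by (simp add: inj_eq)
  ultimately show ?thesis using assms(1) by (simp add: pencil_eigenbasis_def)
qed

text \<open>The characteristic polynomial splits into linear factors at the eigenvalues of some
  eigenbasis, so its sorted roots are a permutation of these; permuting the eigenvectors alike gives
  the basis in sorted order.\<close>

lemma sorted_proots_eigenbasis:
  assumes fin: "finite S" and W: "\<And>x. x \<in> S \<Longrightarrow> W x > 0"
    and sym: "\<And>x y. x \<in> S \<Longrightarrow> y \<in> S \<Longrightarrow> A x y = A y x"
    and M: "\<And>x y. x \<in> S \<Longrightarrow> y \<in> S \<Longrightarrow> M x y = A x y / W x"
  obtains u where
    "pencil_eigenbasis S A W (card S) u ((!) (sorted_list_of_multiset (proots (charpoly_on S M))))"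
    "length (sorted_list_of_multiset (proots (charpoly_on S M))) = card S"
proof -
  define N where "N = card S"
  obtain u e where basis: "pencil_eigenbasis S A W N u e"
    unfolding N_def by (rule pencil_eigenbasis_exists[of S W A]) (use assms in auto)
  define xs where "xs = map e [0..<N]"
  define ls where "ls = sorted_list_of_multiset (proots (charpoly_on S M))"
  have "charpoly_on S M = (\<Prod>c\<leftarrow>xs. [:- c, 1:])"
    unfolding xs_def N_def by (rule charpoly_on_eigenbasis[of S W A u]) (use assms basis N_def in auto)
  moreover have nz: "(\<Prod>c\<leftarrow>ys. [:- c, 1:]) \<noteq> 0" for ys :: "real list"
    by (induction ys) (simp_all del: mult_pCons_left)
  moreover have "proots (\<Prod>c\<leftarrow>ys. [:- c, 1:]) = mset ys" for ys :: "real list"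
  proof (induction ys)
    case (Cons c ys)
    have "proots ([:- c, 1:] * (\<Prod>c\<leftarrow>ys. [:- c, 1:])) =
        proots [:- c, 1:] + proots (\<Prod>c\<leftarrow>ys. [:- c, 1:])"
      by (rule proots_mult) (use nz[of ys] in auto)
    then show ?case by (simp only: Cons.IH list.map prod_list.Cons) simp
  qed simp
  ultimately have mset: "mset ls = mset xs" by (simp add: ls_def)
  then obtain p where p: "p permutes {..<length xs}" "permute_list p xs = ls"
    using mset_eq_permutation by blast
  have len: "length ls = N" "length xs = N" using mset_eq_length[OF mset] by (simp_all add: xs_def)
  have nth: "ls ! i = (e \<circ> p) i" if "i < N" for i
  proof -
    have "p i < N" using permutes_in_image[OF p(1), of i] that len by simp
    moreover have "ls ! i = xs ! p i" using permute_list_nth[OF p(1), of i] p(2) that len by simp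
    ultimately show ?thesis by (simp add: xs_def)
  qed
  have "pencil_eigenbasis S A W N (u \<circ> p) (e \<circ> p)"
    using basis p(1) len by (intro pencil_eigenbasis_permute) auto
  then have "pencil_eigenbasis S A W N (u \<circ> p) ((!) ls)"
    using nth unfolding pencil_eigenbasis_def by simp
  then show thesis using that len by (simp add: ls_def N_def)
qed

section \<open>The Courant-Fischer dimension count\<close>

lemma pencil_eigenbasis_diagonalises:
  assumes basis: "pencil_eigenbasis S A W k u e" and I: "I \<subseteq> {..<k}"
  defines "f \<equiv> \<lambda>c x. \<Sum>i\<in>I. c i * u i x"
  shows "wip S W (f c) (f c) = (\<Sum>i\<in>I. (c i)\<^sup>2)"
    and "bform S A (f c) (f c) = (\<Sum>i\<in>I. e i * (c i)\<^sup>2)"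
proof -
  have fin: "finite I" using I finite_subset by blast
  have coeff: "wip S W (f c) (u j) = c j" if "j \<in> I" for j
  proof -
    have "wip S W (f c) (u j) = (\<Sum>i\<in>I. c i * wip S W (u j) (u i))"
      unfolding f_def by (subst wip_commute) (rule wip_sum_right)
    also have "\<dots> = (\<Sum>i\<in>I. if j = i then c i else 0)"
    proof (intro sum.cong refl)
      fix i assume "i \<in> I"
      then have "i < k" "j < k" using I that by auto
      with basis show "c i * wip S W (u j) (u i) = (if j = i then c i else 0)"
        by (simp add: pencil_eigenbasis_def)
    qed
    finally show ?thesis using fin that by simp
  qed
  have "wip S W (f c) (f c) = (\<Sum>i\<in>I. c i * wip S W (f c) (u i))"
    by (subst (2) f_def) (rule wip_sum_right)
  then show "wip S W (f c) (f c) = (\<Sum>i\<in>I. (c i)\<^sup>2)"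
    by (simp add: coeff power2_eq_square)
  have "bform S A (f c) (f c) = (\<Sum>i\<in>I. c i * bform S A (f c) (u i))"
    by (subst (2) f_def) (rule bform_sum_right)
  also have "\<dots> = (\<Sum>i\<in>I. c i * (e i * wip S W (f c) (u i)))"
    using basis I by (intro sum.cong refl arg_cong2[where f = "(*)"] bform_eigenvector_right)
      (auto simp: pencil_eigenbasis_def)
  finally show "bform S A (f c) (f c) = (\<Sum>i\<in>I. e i * (c i)\<^sup>2)"
    by (simp add: coeff power2_eq_square mult_ac)
qed

text \<open>The unknowns are the coefficients of a vector in the span of the first \<open>p + 1\<close> eigenvectors of
  one pencil and of a vector in the span of the last \<open>N - q\<close> of the other; the equations force the
  two vectors to agree on \<open>S\<close> and to be annihilated by the functionals \<open>t j\<close>.\<close>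

lemma eigenspaces_meet_kernel:
  assumes fin: "finite S" "finite J"
    and basis: "pencil_eigenbasis S A W N u ((!) l)"
    and basis': "pencil_eigenbasis S A' W' N u' ((!) l')"
    and N: "N = card S" "length l = N" "length l' = N"
    and sorted: "sorted l" "sorted l'"
    and pq: "p < N" "q + card J \<le> p"
  obtains f where "\<exists>x\<in>S. f x \<noteq> 0" "\<And>j. j \<in> J \<Longrightarrow> (\<Sum>x\<in>S. t j x * f x) = 0"
    "bform S A f f \<le> l ! p * wip S W f f" "l' ! q * wip S W' f f \<le> bform S A' f f"
proof -
  let ?I = "{..p}" and ?I' = "{q..<N}"
  let ?a = "\<lambda>r i. case r of
      Inl x \<Rightarrow> (case i of Inl i \<Rightarrow> u i x | Inr i \<Rightarrow> - u' i x)
    | Inr j \<Rightarrow> (case i of Inl i \<Rightarrow> \<Sum>x\<in>S. t j x * u i x | Inr i \<Rightarrow> 0)"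
  \<comment> \<open>There are \<open>N + card J\<close> equations in
    \<open>(p + 1) + (N - q)\<close> unknowns, and \<open>q + card J <= p\<close>.\<close>
  have "card (S <+> J) < card (?I <+> ?I')"
    using fin N pq by (simp add: card_Plus)
  then obtain c where c: "\<exists>i\<in>?I <+> ?I'. c i \<noteq> 0"
    "\<forall>r\<in>S <+> J. (\<Sum>i\<in>?I <+> ?I'. ?a r i * c i) = 0"
    using homogeneous_system_nontrivial[of "S <+> J" "?I <+> ?I'" ?a] fin by auto
  define f where "f x = (\<Sum>i\<in>?I. c (Inl i) * u i x)" for x
  define f' where "f' x = (\<Sum>i\<in>?I'. c (Inr i) * u' i x)" for x
  have eq: "f x = f' x" if "x \<in> S" for x
    using c(2)[rule_format, OF InlI[OF that]]
    by (simp add: sum.Plus f_def f'_def sum_negf mult.commute)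
  have ker: "(\<Sum>x\<in>S. t j x * f x) = 0" if "j \<in> J" for j
  proof -
    have "(\<Sum>x\<in>S. t j x * f x) = (\<Sum>i\<in>?I. (\<Sum>x\<in>S. t j x * u i x) * c (Inl i))"
      unfolding f_def sum_distrib_left sum_distrib_right by (subst sum.swap) (simp add: mult_ac)
    also have "\<dots> = 0"
      using c(2)[rule_format, OF InrI[OF that]] by (simp add: sum.Plus)
    finally show ?thesis .
  qed
  have I: "?I \<subseteq> {..<N}" "?I' \<subseteq> {..<N}" using pq by auto
  have diag: "wip S W f f = (\<Sum>i\<in>?I. (c (Inl i))\<^sup>2)"
    "bform S A f f = (\<Sum>i\<in>?I. l ! i * (c (Inl i))\<^sup>2)"
    unfolding f_def using pencil_eigenbasis_diagonalises[OF basis I(1), of "\<lambda>i. c (Inl i)"] by auto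
  have "wip S W' f f = wip S W' f' f'" "bform S A' f f = bform S A' f' f'"
    using eq by (auto intro: wip_cong bform_cong)
  then have diag': "wip S W' f f = (\<Sum>i\<in>?I'. (c (Inr i))\<^sup>2)"
    "bform S A' f f = (\<Sum>i\<in>?I'. l' ! i * (c (Inr i))\<^sup>2)"
    unfolding f'_def using pencil_eigenbasis_diagonalises[OF basis' I(2), of "\<lambda>i. c (Inr i)"] by auto
  \<comment> \<open>If \<open>f\<close> vanished on \<open>S\<close>, both sums of squared
    coefficients in \<open>diag\<close> and \<open>diag'\<close> would be 0, and the solution
    \<open>c\<close> would be trivial.\<close>
  have "\<exists>x\<in>S. f x \<noteq> 0"
  proof (rule ccontr)
    assume "\<not> ?thesis"
    then have "wip S W f f = 0" "wip S W' f f = 0" by (auto simp: wip_def)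
    then have "\<forall>i\<in>?I. (c (Inl i))\<^sup>2 = 0" "\<forall>i\<in>?I'. (c (Inr i))\<^sup>2 = 0"
      unfolding diag diag' by (subst (asm) sum_nonneg_eq_0_iff; auto)+
    with c(1) show False by auto
  qed
  moreover have "bform S A f f \<le> l ! p * wip S W f f"
    unfolding diag sum_distrib_left using sorted N pq
    by (intro sum_mono mult_right_mono sorted_nth_mono) auto
  moreover have "l' ! q * wip S W' f f \<le> bform S A' f f"
    unfolding diag' sum_distrib_left using sorted N pq
    by (intro sum_mono mult_right_mono sorted_nth_mono) auto
  ultimately show thesis using that ker by blast
qed

section \<open>The up-Laplacian as a pencil\<close>

lemma finite_faces: "is_complex K \<Longrightarrow> finite (faces K n)"
  by (simp add: is_complex_def faces_def)

lemma subface_in_complex: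
  assumes "is_complex K" "F \<in> K" "G \<noteq> {}" "G \<subseteq> F"
  shows "G \<in> K"
proof -
  have "\<forall>G. G \<subseteq> F \<and> G \<noteq> {} \<longrightarrow> G \<in> K" using assms(1,2) by (simp add: is_complex_def)
  with assms(3,4) show ?thesis by simp
qed

lemma face_remove_vertex:
  assumes "is_complex K" "Fb \<in> faces K (n + 1)" "x \<in> Fb"
  shows "Fb - {x} \<in> faces K n"
proof -
  have Fb: "Fb \<in> K" "card Fb = n + 2" using assms(2) by (auto simp: faces_def)
  then have card: "card (Fb - {x}) = n + 1" using assms(3) by simp
  then have "Fb - {x} \<noteq> {}" by (metis card.empty Suc_eq_plus1 Zero_not_Suc)
  with assms(1) Fb(1) have "Fb - {x} \<in> K" by (rule subface_in_complex) auto
  with card show ?thesis by (simp add: faces_def)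
qed

lemma sum_elem_cochain:
  assumes "finite S"
  shows "(\<Sum>F\<in>S. f F * elem_cochain F G) = (if G \<in> S then f G else 0)"
proof -
  have "(\<Sum>F\<in>S. f F * elem_cochain F G) = (\<Sum>F\<in>S. if G = F then f F else 0)"
    by (intro sum.cong) (auto simp: elem_cochain_def)
  then show ?thesis using assms by simp
qed

lemma coboundary_expand:
  assumes "is_complex K"
  shows "coboundary K n f Fb = (\<Sum>F\<in>faces K n. f F * coboundary K n (elem_cochain F) Fb)"
proof (cases "Fb \<in> faces K (n + 1)")
  case True
  let ?s = "\<lambda>x. (- 1) ^ card {v \<in> Fb. v < x} :: real"
  have "f (Fb - {x}) = (\<Sum>F\<in>faces K n. f F * elem_cochain F (Fb - {x}))" if "x \<in> Fb" for x
    using face_remove_vertex[OF assms True that] by (simp add: sum_elem_cochain finite_faces assms)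
  then have "coboundary K n f Fb = (\<Sum>x\<in>Fb. \<Sum>F\<in>faces K n. ?s x * (f F * elem_cochain F (Fb - {x})))"
    using True by (simp add: coboundary_def sum_distrib_left)
  also have "\<dots> = (\<Sum>F\<in>faces K n. f F * coboundary K n (elem_cochain F) Fb)"
    using True by (subst sum.swap) (simp add: coboundary_def sum_distrib_left mult_ac)
  finally show ?thesis .
qed (simp add: coboundary_def)

text \<open>Among the facets of \<open>Fb\<close> only the one omitting the vertex \<open>x\<close>
  equals \<open>F\<close>, so a single signed term survives. Thus the matrix of the coboundary
  consists of incidence numbers.\<close>

lemma coboundary_elem_cochain:
  assumes "F \<in> faces K n" "Fb \<in> faces K (n + 1)"
  shows "coboundary K n (elem_cochain F) Fb = (if F \<subset> Fb then osgn F Fb else 0)"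
proof (cases "F \<subset> Fb")
  case True
  have fin: "finite Fb" "finite F" and card: "card Fb = Suc (card F)"
    using assms by (auto simp: faces_def intro: card_ge_0_finite)
  then have "card (Fb - F) = 1" using True by (simp add: card_Diff_subset)
  then obtain x where x: "Fb - F = {x}" by (auto simp: card_1_singleton_iff)
  have remove: "Fb - {y} = F \<longleftrightarrow> y = x" if "y \<in> Fb" for y
    using x True that by auto
  have "coboundary K n (elem_cochain F) Fb =
      (\<Sum>y\<in>Fb. if y = x then (- 1) ^ card {v \<in> Fb. v < y} else 0)"
    using assms(2) by (auto simp: coboundary_def elem_cochain_def remove intro!: sum.cong)
  also have "\<dots> = osgn F Fb"
    using fin x by (auto simp: osgn_def)
  finally show ?thesis using True by simp
next
  case False
  have "Fb - {x} \<noteq> F" if "x \<in> Fb" for x using False that by auto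
  then show ?thesis using False by (simp add: coboundary_def elem_cochain_def)
qed

text \<open>The coboundary matrix transposed, times the diagonal of weights of
  \<open>(n + 1)\<close>-faces, times the coboundary matrix. It is symmetric; dividing its rows by
  the weights of the \<open>n\<close>-faces gives the up-Laplacian, which turns the eigenvalue
  problem into one for a pencil.\<close>

definition up_gram :: "'v::linorder set set \<Rightarrow> ('v set \<Rightarrow> real) \<Rightarrow> nat \<Rightarrow> 'v set \<Rightarrow> 'v set \<Rightarrow> real" where
  "up_gram K w n F G = (\<Sum>Fb\<in>faces K (n + 1).
     w Fb * coboundary K n (elem_cochain F) Fb * coboundary K n (elem_cochain G) Fb)"

lemma up_laplacian_matrix_eq:
  assumes "is_complex K" "F \<in> faces K n"
  shows "up_laplacian_matrix K w n F G = (if w F = 0 then 0 else up_gram K w n F G / w F)"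
proof (cases "w F = 0")
  case False
  let ?d = "\<lambda>F Fb. coboundary K n (elem_cochain F) Fb"
  have "up_laplacian_matrix K w n F G =
      (\<Sum>Fb | Fb \<in> faces K (n + 1) \<and> F \<subset> Fb. w Fb / w F * osgn F Fb * ?d G Fb)"
    using False assms(2) by (simp add: up_laplacian_matrix_def up_laplacian_def coboundary_adj_def)
  also have "\<dots> = (\<Sum>Fb\<in>faces K (n + 1). w Fb / w F * ?d F Fb * ?d G Fb)"
    using finite_faces[OF assms(1)] coboundary_elem_cochain[OF assms(2)]
    by (intro sum.mono_neutral_cong_left) auto
  also have "\<dots> = up_gram K w n F G / w F"
    by (simp add: up_gram_def sum_divide_distrib)
  finally show ?thesis using False by simp
qed (simp add: up_laplacian_matrix_def up_laplacian_def coboundary_adj_def)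

lemma up_gram_commute: "up_gram K w n F G = up_gram K w n G F"
  by (simp add: up_gram_def mult_ac)

text \<open>Expanding the coboundary of \<open>f\<close> in elementary cochains turns the double sum
  over \<open>n\<close>-faces into a square for each \<open>Fb\<close>. This is the form
  \<open>E\<close> in which the two complexes are compared.\<close>

lemma bform_up_gram:
  assumes "is_complex K"
  shows "bform (faces K n) (up_gram K w n) f f =
    (\<Sum>Fb\<in>faces K (n + 1). w Fb * (coboundary K n f Fb)\<^sup>2)"
proof -
  let ?S = "faces K n" and ?T = "faces K (n + 1)"
  let ?d = "\<lambda>F Fb. coboundary K n (elem_cochain F) Fb"
  have app: "mat_app ?S (up_gram K w n) f F = (\<Sum>Fb\<in>?T. w Fb * coboundary K n f Fb * ?d F Fb)" for F
  proof -
    have "mat_app ?S (up_gram K w n) f F = (\<Sum>Fb\<in>?T. \<Sum>G\<in>?S. w Fb * ?d F Fb * (f G * ?d G Fb))"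
      unfolding mat_app_def up_gram_def sum_distrib_right by (subst sum.swap) (simp add: mult_ac)
    also have "\<dots> = (\<Sum>Fb\<in>?T. w Fb * ?d F Fb * coboundary K n f Fb)"
      by (simp only: coboundary_expand[OF assms, of n f] flip: sum_distrib_left)
    finally show ?thesis by (simp add: mult_ac)
  qed
  have "bform ?S (up_gram K w n) f f =
      (\<Sum>Fb\<in>?T. \<Sum>F\<in>?S. w Fb * coboundary K n f Fb * (f F * ?d F Fb))"
    unfolding bform_def app sum_distrib_left by (subst sum.swap) (simp add: mult_ac)
  also have "\<dots> = (\<Sum>Fb\<in>?T. w Fb * coboundary K n f Fb * coboundary K n f Fb)"
    by (simp only: coboundary_expand[OF assms, of n f] flip: sum_distrib_left)
  finally show ?thesis by (simp add: power2_eq_square mult_ac)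
qed

text \<open>Where \<open>w\<close> vanishes, the corresponding row of the Gram matrix is zero, so there \<open>W\<close> may be any
  positive number without changing the eigenvalues.\<close>

lemma up_eigenvalues_eigenbasis:
  assumes K: "is_complex K"
    and W: "\<And>F. F \<in> faces K n \<Longrightarrow> W F > 0" "\<And>F. F \<in> faces K n \<Longrightarrow> w F \<noteq> 0 \<Longrightarrow> W F = w F"
    and degenerate: "\<And>F Fb. F \<in> faces K n \<Longrightarrow> Fb \<in> faces K (n + 1) \<Longrightarrow> F \<subset> Fb \<Longrightarrow> w F = 0 \<Longrightarrow> w Fb = 0"
  obtains u where
    "pencil_eigenbasis (faces K n) (up_gram K w n) W (card (faces K n)) u ((!) (up_eigenvalues K w n))"
    "length (up_eigenvalues K w n) = card (faces K n)"
proof -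
  have M: "up_laplacian_matrix K w n F G = up_gram K w n F G / W F" if F: "F \<in> faces K n" for F G
  proof (cases "w F = 0")
    case True
    have "up_gram K w n F G = 0"
      unfolding up_gram_def
      using coboundary_elem_cochain[OF F] degenerate[OF F _ _ True] by (intro sum.neutral) auto
    then show ?thesis using up_laplacian_matrix_eq[OF K F] True by simp
  next
    case False
    then show ?thesis using up_laplacian_matrix_eq[OF K F] W(2)[OF F] by simp
  qed
  show thesis
    by (rule sorted_proots_eigenbasis[OF finite_faces[OF K] W(1) up_gram_commute M])
      (auto simp: up_eigenvalues_def intro: that)
qed

lemma sorted_up_eigenvalues: "sorted (up_eigenvalues K w n)"
  by (simp add: up_eigenvalues_def)

section \<open>Dimensions of cochain spaces and the rank of the coboundary\<close>

interpretation fun_space: vector_space fun_scale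
  by unfold_locales (auto simp: fun_scale_def algebra_simps)

lemma sum_fun_scale_apply: "(\<Sum>i\<in>I. fun_scale (c i) (g i)) x = (\<Sum>i\<in>I. c i * g i x)"
  by (induction I rule: infinite_finite_induct) (auto simp: fun_scale_def)

lemma cochains_subset_span:
  assumes "is_complex K"
  shows "cochains K j \<subseteq> fun_space.span (elem_cochain ` faces K j)"
proof
  fix f assume f: "f \<in> cochains K j"
  have "f = (\<Sum>F\<in>faces K j. fun_scale (f F) (elem_cochain F))"
  proof
    fix G
    show "f G = (\<Sum>F\<in>faces K j. fun_scale (f F) (elem_cochain F)) G"
      using f by (simp add: sum_fun_scale_apply sum_elem_cochain finite_faces assms cochains_def)
  qed
  also have "\<dots> \<in> fun_space.span (elem_cochain ` faces K j)"
    by (intro fun_space.span_sum fun_space.span_scale fun_space.span_base) simp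
  finally show "f \<in> fun_space.span (elem_cochain ` faces K j)" .
qed

lemma vdim_le_card_faces:
  assumes "is_complex K" "V \<subseteq> cochains K j"
  shows "vdim V \<le> card (faces K j)"
proof -
  have "vdim V \<le> card (elem_cochain ` faces K j)"
    unfolding vdim_def
    by (rule fun_space.dim_le_card) (use cochains_subset_span assms finite_faces in blast)+
  also have "\<dots> \<le> card (faces K j)" by (rule card_image_le) (rule finite_faces[OF assms(1)])
  finally show ?thesis .
qed

lemma coboundary_image_subset: "coboundary K n ` V \<subseteq> cochains K (n + 1)"
  by (auto simp: cochains_def coboundary_def)

text \<open>Expressing coboundaries in a basis \<open>B\<close> of the image allows the condition of
  zero coboundary to be imposed by only as many linear equations as the rank, one functional
  \<open>t b\<close> for each basis vector.\<close>

lemma coboundary_coordinates: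
  assumes K: "is_complex K"
  obtains B :: "('v::linorder set \<Rightarrow> real) set" and t where
    "finite B" "card B = vdim (coboundary K n ` cochains K n)"
    "\<And>F Fb. F \<in> faces K n \<Longrightarrow> coboundary K n (elem_cochain F) Fb = (\<Sum>b\<in>B. t b F * b Fb)"
proof -
  let ?V = "coboundary K n ` cochains K n"
  obtain B where B: "B \<subseteq> ?V" "fun_space.independent B" "?V \<subseteq> fun_space.span B"
    "card B = fun_space.dim ?V"
    by (rule fun_space.basis_exists)
  have "B \<subseteq> fun_space.span (elem_cochain ` faces K (n + 1))"
    using B(1) coboundary_image_subset cochains_subset_span[OF K] by blast
  then have fin: "finite B"
    using fun_space.independent_span_bound[OF _ B(2)] finite_faces[OF K] by blast
  have "\<exists>t. coboundary K n (elem_cochain F) = (\<Sum>b\<in>B. fun_scale (t b) b)" if "F \<in> faces K n" for F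
  proof -
    have "elem_cochain F \<in> cochains K n" using that by (auto simp: cochains_def elem_cochain_def)
    then have "coboundary K n (elem_cochain F) \<in> fun_space.span B" using B(3) by blast
    then show ?thesis unfolding fun_space.span_finite[OF fin] by blast
  qed
  then obtain t where t: "\<And>F. F \<in> faces K n \<Longrightarrow>
      coboundary K n (elem_cochain F) = (\<Sum>b\<in>B. fun_scale (t F b) b)"
    by metis
  show thesis
  proof (rule that[OF fin, of "\<lambda>b F. t F b"])
    show "card B = vdim ?V" using B(4) by (simp add: vdim_def)
  qed (simp add: t sum_fun_scale_apply)
qed

lemma coboundary_subcomplex:
  "H \<subseteq> K \<Longrightarrow> Fb \<in> faces H (n + 1) \<Longrightarrow> coboundary K n f Fb = coboundary H n f Fb"
  by (auto simp: coboundary_def faces_def)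

text \<open>The kernel has dimension at most the number of \<open>(n + 1)\<close>-faces, so
  subtracting kernel minus image from that number leaves at least the image. The bound on the image
  itself covers the case where truncated subtraction yields 0.\<close>

lemma coboundary_rank_le:
  assumes "is_complex H"
  shows "vdim (coboundary H n ` cochains H n) \<le> card (faces H (n + 1)) - cohomology_dim H (n + 1)"
proof -
  have "vdim (coboundary H n ` cochains H n) \<le> card (faces H (n + 1))"
    by (rule vdim_le_card_faces[OF assms coboundary_image_subset])
  moreover have "vdim {f \<in> cochains H (n + 1). coboundary H (n + 1) f = (\<lambda>_. 0)} \<le> card (faces H (n + 1))"
    by (rule vdim_le_card_faces[OF assms]) auto
  ultimately show ?thesis by (simp add: cohomology_dim_def)
qed

section \<open>Comparison of the two complexes\<close>

theorem theorem1p1: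
  fixes n :: nat
    and K H L :: "'v::linorder set set"
    and wK wH wL :: "'v set \<Rightarrow> real"
  assumes "weighted_complex K wK" and "is_dim K (n + 1)"
    and "weighted_complex H wH" and "is_dim H (n + 1)"
    and "weighted_subcomplex H wH K wK"
    and "proper_difference K wK H wH L wL"
  defines "N \<equiv> card (faces K n)"
    and "lam \<equiv> up_eigenvalues K wK n"
    and "theta \<equiv> up_eigenvalues L wL n"
    and "DW \<equiv> card (faces H (n + 1)) - cohomology_dim H (n + 1)"
    and "DH \<equiv> card (faces H n)"
  shows "(\<forall>k. 1 \<le> k \<and> k \<le> N - DH \<longrightarrow> eig theta (int k) \<le> eig lam (int k + int DH))
       \<and> (\<forall>k. 1 \<le> k \<and> k \<le> N \<longrightarrow> eig lam (int k - int DW) \<le> eig theta (int k))"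
proof -
  have K: "is_complex K" and H: "is_complex H" and HK: "H \<subseteq> K" and LK: "L = K"
    and supp: "is_complex {F \<in> K. F \<noteq> {} \<and> wL F > 0}"
    using assms by (auto simp: weighted_complex_def weighted_subcomplex_def proper_difference_def)
  have face: "F \<in> K" "F \<noteq> {}" "wK F > 0" if "F \<in> faces K j" for F j
    using that assms(1) by (auto simp: faces_def weighted_complex_def)
  have wL_off: "wL F = wK F" if "F \<in> faces K j" "F \<notin> H" for F j
    using assms(6) face[OF that(1)] that(2) by (simp add: proper_difference_def ext_weight_def)
  have wL_bounds: "0 \<le> wL F" "wL F \<le> wK F" if "F \<in> faces K j" for F j
    using assms(3,5,6) face[OF that]
    by (auto simp: weighted_complex_def weighted_subcomplex_def proper_difference_def
        ext_weight_def intro: less_imp_le)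
  define S where "S = faces K n"
  \<comment> \<open>chosen positive, bounded by \<open>wK\<close>, and equal to \<open>wK\<close> off \<open>H\<close>\<close>
  define W where "W F = (if wL F = 0 then wK F else wL F)" for F
  have W: "W F > 0" "W F \<le> wK F" if "F \<in> S" for F
    using wL_bounds[of F n] face[of F n] that by (auto simp: W_def S_def)
  have fin: "finite S" "finite (faces H n)" and sub: "faces H n \<subseteq> S"
    using finite_faces K H HK by (auto simp: S_def faces_def)
  obtain u where u: "pencil_eigenbasis S (up_gram K wK n) wK N u ((!) lam)" "length lam = N"
    unfolding S_def N_def lam_def
    by (rule up_eigenvalues_eigenbasis[OF K, of n wK wK]) (use face in force)+
  \<comment> \<open>The faces of positive \<open>wL\<close> form a complex, so a face of weight 0
    has no coface of positive weight.\<close>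
  have degenerate: "wL Fb = 0"
    if "F \<in> faces K n" "Fb \<in> faces K (n + 1)" "F \<subset> Fb" "wL F = 0" for F Fb
  proof (rule ccontr)
    assume "wL Fb \<noteq> 0"
    then have "wL Fb > 0" using wL_bounds(1)[OF that(2)] by simp
    then have "Fb \<in> {F \<in> K. F \<noteq> {} \<and> wL F > 0}" using face[OF that(2)] by simp
    then have "F \<in> {F \<in> K. F \<noteq> {} \<and> wL F > 0}"
      using supp face(2)[OF that(1)] that(3) by (intro subface_in_complex[of _ Fb F]) auto
    with that(4) show False by simp
  qed
  obtain v where v: "pencil_eigenbasis S (up_gram K wL n) W N v ((!) theta)" "length theta = N"
    unfolding S_def N_def theta_def LK
    by (rule up_eigenvalues_eigenbasis[OF K, of n W wL])
      (use W degenerate in \<open>auto simp: S_def W_def\<close>)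
  have sorted: "sorted lam" "sorted theta" by (simp_all add: lam_def theta_def sorted_up_eigenvalues)
  \<comment> \<open>The weights \<open>wL\<close> and \<open>wK\<close> differ only on faces of
    \<open>H\<close>, and there the coboundary of \<open>f\<close> is 0.\<close>
  have same_form: "bform S (up_gram K wL n) f f = bform S (up_gram K wK n) f f"
    if "\<And>Fb. Fb \<in> faces H (n + 1) \<Longrightarrow> coboundary H n f Fb = 0" for f
    unfolding S_def bform_up_gram[OF K]
  proof (intro sum.cong refl)
    fix Fb assume Fb: "Fb \<in> faces K (n + 1)"
    show "wL Fb * (coboundary K n f Fb)\<^sup>2 = wK Fb * (coboundary K n f Fb)\<^sup>2"
    proof (cases "Fb \<in> H")
      case True
      then have "Fb \<in> faces H (n + 1)" using Fb by (simp add: faces_def)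
      then show ?thesis using that coboundary_subcomplex[OF HK] by simp
    qed (simp add: wL_off[OF Fb])
  qed
  have wip_pos: "wip S wK f f > 0" if "\<exists>x\<in>S. f x \<noteq> 0" for f
  proof -
    have wK: "wK F > 0" if "F \<in> S" for F using face(3) that by (simp add: S_def)
    have "wip S wK f f \<noteq> 0" using wip_eq_0_iff[OF fin(1) wK] that by simp
    moreover have "wip S wK f f \<ge> 0" by (rule wip_nonneg) (use wK in \<open>auto intro: less_imp_le\<close>)
    ultimately show ?thesis by simp
  qed
  \<comment> \<open>\<open>eig\<close> counts from 1, list positions from 0.\<close>
  have eig_nth: "eig ls (int j) = ls ! (j - 1)" if "j \<ge> 1" for ls j
  proof -
    have "nat (int j - 1) = j - 1" using that by linarith
    then show ?thesis using that by (simp add: eig_def)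
  qed
  show ?thesis
  proof (intro conjI allI impI; elim conjE)
    fix k assume k: "1 \<le> k" "k \<le> N - DH"
    \<comment> \<open>The functionals evaluate \<open>f\<close> at the \<open>DH\<close> faces of
      \<open>H\<close>; with \<open>p = k + DH - 1\<close> and \<open>q = k - 1\<close> the
      dimension count is exactly tight.\<close>
    obtain f where f: "\<exists>x\<in>S. f x \<noteq> 0"
      "\<And>F. F \<in> faces H n \<Longrightarrow> (\<Sum>x\<in>S. (if x = F then 1 else 0) * f x) = 0"
      "bform S (up_gram K wK n) f f \<le> lam ! (k + DH - 1) * wip S wK f f"
      "theta ! (k - 1) * wip S W f f \<le> bform S (up_gram K wL n) f f"
      by (rule eigenspaces_meet_kernel[OF fin u(1) v(1), of "k + DH - 1" "k - 1" "\<lambda>F x. if x = F then 1 else 0"])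
        (use k u v sorted in \<open>auto simp: N_def S_def DH_def\<close>)
    have f0: "f F = 0" if "F \<in> faces H n" for F
    proof -
      have "(\<Sum>x\<in>S. (if x = F then 1 else 0) * f x) = (\<Sum>x\<in>S. if x = F then f x else 0)"
        by (rule sum.cong) auto
      also have "\<dots> = f F" using fin sub that by auto
      finally show ?thesis using f(2)[OF that] by simp
    qed
    have "coboundary H n f Fb = 0" for Fb
      by (subst coboundary_expand[OF H]) (simp add: f0)
    moreover have "wip S W f f = wip S wK f f"
      unfolding wip_def
    proof (intro sum.cong refl)
      fix F assume F: "F \<in> S"
      show "W F * f F * f F = wK F * f F * f F"
      proof (cases "F \<in> H")
        case True
        then show ?thesis using f0 F by (simp add: S_def faces_def)
      next
        case False
        then show ?thesis using wL_off[of F n] F by (simp add: W_def S_def)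
      qed
    qed
    ultimately have "theta ! (k - 1) * wip S wK f f \<le> lam ! (k + DH - 1) * wip S wK f f"
      using f(3,4) same_form[of f] by simp
    then have "theta ! (k - 1) \<le> lam ! (k + DH - 1)"
      using wip_pos[OF f(1)] by simp
    then show "eig theta (int k) \<le> eig lam (int k + int DH)"
      using eig_nth[of k theta] eig_nth[of "k + DH" lam] k by simp
  next
    fix k assume k: "1 \<le> k" "k \<le> N"
    \<comment> \<open>Used twice: against the convention that eigenvalues of index at most 0 are 0,
      and to keep the direction of the inequality when \<open>wip S W f f\<close> is replaced by the
      larger \<open>wip S wK f f\<close>.\<close>
    have theta_nonneg: "theta ! (k - 1) \<ge> 0"
    proof -
      let ?v = "v (k - 1)"
      have "bform S (up_gram K wL n) ?v ?v = theta ! (k - 1) * wip S W ?v ?v"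
        using v(1) k by (intro bform_eigenvector_right) (simp add: pencil_eigenbasis_def)
      also have "wip S W ?v ?v = 1" using v(1) k by (simp add: pencil_eigenbasis_def)
      finally have "theta ! (k - 1) = bform S (up_gram K wL n) ?v ?v" by simp
      also have "\<dots> \<ge> 0"
        unfolding S_def bform_up_gram[OF K] using wL_bounds(1)
        by (intro sum_nonneg mult_nonneg_nonneg) auto
      finally show ?thesis .
    qed
    show "eig lam (int k - int DW) \<le> eig theta (int k)"
    proof (cases "k \<le> DW")
      case True
      then show ?thesis using theta_nonneg eig_nth[of k theta] k by (simp add: eig_def)
    next
      case False
      obtain B t where B: "finite B" "card B = vdim (coboundary H n ` cochains H n)"
        "\<And>F Fb. F \<in> faces H n \<Longrightarrow> coboundary H n (elem_cochain F) Fb = (\<Sum>b\<in>B. t b F * b Fb)"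
        by (rule coboundary_coordinates[OF H, of n]) blast
      have card: "card B \<le> DW" using B(2) coboundary_rank_le[OF H] by (simp add: DW_def)
      \<comment> \<open>Extension by 0 turns the functionals on \<open>n\<close>-cochains of
        \<open>H\<close> into functionals on all of \<open>S\<close>.\<close>
      let ?t = "\<lambda>b F. if F \<in> faces H n then t b F else 0"
      \<comment> \<open>The pencils exchange roles: low eigenvectors of \<open>L\<close> meet high
        ones of \<open>K\<close>. The count works because \<open>card B <= DW\<close> and
        \<open>p - q = DW\<close>.\<close>
      obtain f where f: "\<exists>x\<in>S. f x \<noteq> 0" "\<And>b. b \<in> B \<Longrightarrow> (\<Sum>x\<in>S. ?t b x * f x) = 0"
        "bform S (up_gram K wL n) f f \<le> theta ! (k - 1) * wip S W f f"
        "lam ! (k - DW - 1) * wip S wK f f \<le> bform S (up_gram K wK n) f f"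
        by (rule eigenspaces_meet_kernel[OF fin(1) B(1) v(1) u(1), of "k - 1" "k - DW - 1" ?t])
          (use k False card u v sorted in \<open>auto simp: N_def S_def\<close>)
      have "coboundary H n f Fb = 0" for Fb
      proof -
        have "coboundary H n f Fb = (\<Sum>F\<in>faces H n. \<Sum>b\<in>B. b Fb * (t b F * f F))"
          by (subst coboundary_expand[OF H]) (simp add: B(3) sum_distrib_left mult_ac)
        also have "\<dots> = (\<Sum>b\<in>B. b Fb * (\<Sum>F\<in>faces H n. t b F * f F))"
          by (subst sum.swap) (simp add: sum_distrib_left)
        also have "\<dots> = (\<Sum>b\<in>B. b Fb * (\<Sum>x\<in>S. ?t b x * f x))"
          by (intro sum.cong refl arg_cong2[where f = "(*)"] sum.mono_neutral_cong_left)
            (use fin sub in auto)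
        also have "\<dots> = 0" using f(2) by (intro sum.neutral) simp
        finally show ?thesis .
      qed
      then have "lam ! (k - DW - 1) * wip S wK f f \<le> theta ! (k - 1) * wip S W f f"
        using f(3,4) same_form[of f] by simp
      also have "wip S W f f \<le> wip S wK f f"
        unfolding wip_def mult.assoc by (intro sum_mono mult_right_mono W) auto
      then have "theta ! (k - 1) * wip S W f f \<le> theta ! (k - 1) * wip S wK f f"
        using theta_nonneg by (rule mult_left_mono)
      finally have "lam ! (k - DW - 1) \<le> theta ! (k - 1)"
        using wip_pos[OF f(1)] by simp
      then show ?thesis
        using eig_nth[of k theta] eig_nth[of "k - DW" lam] k False by simp
    qed
  qed
qed

end
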